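(* There exist positive absolute constants $C_9,C_{10}$ such that for all integers $n\ge1$, $m\ge1$ and every trigonometric polynomial $P_n$ of order at most $n$, $$C_9\|\mathbf{p_n}\|_{m,\infty}\le\|P_n\|_{m,\infty}\le C_{10}\|\mathbf{p_n}\|_{m,\infty},$$ where $\mathbf{p_n}:=\big(P_n(t_k)\big)_{k=1}^{8n}$ and $t_k:=\frac{k-1}{8n}2\pi$.
   Context: A trigonometric polynomial of order at most $n$ is a function $P_n(x)=\sum_{k=-n}^n c_ke^{ikx}$ (real or complex valued). For such a polynomial the integral-uniform norm is taken on $[0,2\pi]$ with normalized Lebesgue measure $dx/(2\pi)$: $$\|P_n\|_{m,\infty}:=\frac1{(2\pi)^m}\int_0^{2\pi}\cdots\int_0^{2\pi}\max\{|P_n(x_1)|,\dots,|P_n(x_m)|\}\,dx_1\cdots dx_m.$$ For a vector $\mathbf x=(x_k)_{k=1}^N$, $$\|\mathbf x\|_{m,\infty}:=\frac1{N^m}\sum_{k_1=1}^N\cdots\sum_{k_m=1}^N\max_{1\le j\le m}|x_{k_j}|.$$ *)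

theory Defs
  imports "HOL-Analysis.Analysis"
begin

definition trig_poly :: "nat \<Rightarrow> (real \<Rightarrow> complex) \<Rightarrow> bool" where
  "trig_poly n P \<longleftrightarrow>
     (\<exists>c :: int \<Rightarrow> complex. \<forall>x. P x = (\<Sum>k = - int n..int n. c k * exp (\<i> * of_int k * of_real x)))"

(* The m-fold integral is taken with respect to the product measure on functions with
   domain {1..m}; the integration set is the cube [0, 2 pi]^m. *)
definition fun_norm_minf :: "nat \<Rightarrow> (real \<Rightarrow> complex) \<Rightarrow> real" where
  "fun_norm_minf m P =
     1 / (2 * pi) ^ m *
     (LINT x : ({1..m} \<rightarrow>\<^sub>E {0..2 * pi}) | (\<Pi>\<^sub>M j\<in>{1..m}. lborel). (MAX j\<in>{1..m}. cmod (P (x j))))"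

(* A vector of length N is a function on nat of which only the entries 1, ..., N are used;
   the m-fold sum runs over all index tuples (k 1, ..., k m) in {1..N}^m. *)
definition vec_norm_minf :: "nat \<Rightarrow> nat \<Rightarrow> (nat \<Rightarrow> complex) \<Rightarrow> real" where
  "vec_norm_minf N m v =
     1 / real N ^ m * (\<Sum>k \<in> {1..m} \<rightarrow>\<^sub>E {1..N}. (MAX j\<in>{1..m}. cmod (v (k j))))"

definition grid_point :: "nat \<Rightarrow> nat \<Rightarrow> real" where
  "grid_point n k = (real k - 1) / (8 * real n) * (2 * pi)"

end

theory Submission
  imports Defs "HOL-Library.Real_Mod"
begin

text \<open>
  Both norms are expectations of \<open>max\<^sub>j \<bar>P(X\<^sub>j)\<bar>\<close> for \<open>m\<close> independent points \<open>X\<^sub>j\<close>: uniform on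
  \<open>[0, 2 pi]\<close> for the function norm, uniform on the grid for the vector norm. The two point
  distributions \<open>X\<close> and \<open>Y\<close> play symmetric roles, because all that matters is that each of them
  integrates trigonometric polynomials of degree below \<open>3n\<close> exactly. The constants \<open>1/3\<close> and \<open>3\<close>
  then come from proving one inequality and using it in both directions.

  Write \<open>F\<^sub>N\<close> for the Fejer kernel. The de la Vallee Poussin kernel \<open>V = 2 F\<^sub>2\<^sub>n - F\<^sub>n\<close> has Fourier
  coefficients 1 up to degree \<open>n\<close> and has degree below \<open>2n\<close>, so exactness gives the reproducing formula
  \<open>P(x) = E V(x - Y) P(Y)\<close> (lemma \<open>trig_poly_le_vp_average\<close> is its absolute form). Since Fejer
  kernels are nonnegative, \<open>V\<close> is dominated by \<open>K = 2 F\<^sub>2\<^sub>n + F\<^sub>n\<close>, whose mean is 3 under either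
  distribution (lemma \<open>nn_integral_vp_majorant\<close>). Hence \<open>K(x - y) / 3\<close> is, relative to the two
  distributions, the density of a coupling of \<open>X\<close> and \<open>Y\<close>, and the reproducing formula becomes
  \<open>\<bar>P(X)\<bar> \<le> 3 E[\<bar>P(Y)\<bar> | X]\<close>.

  Now take \<open>m\<close> independent copies of the coupled pair. The maximum of the conditional expectations
  is at most the conditional expectation of the maximum, so
  \<open>E max\<^sub>j \<bar>P(X\<^sub>j)\<bar> \<le> 3 E max\<^sub>j \<bar>P(Y\<^sub>j)\<bar>\<close> with a constant independent of \<open>m\<close>. This is lemma
  \<open>nn_integral_Max_coupling\<close>.
\<close>

section \<open>Means of maxima under a coupling\<close>

text \<open>
  The kernel \<open>k\<close> is the joint density of a coupling whose marginals have densities \<open>\<rho>\<close> and \<open>\<sigma>\<close>.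
  Hypothesis \<open>dom\<close> bounds \<open>f(X)\<close> by \<open>c\<close> times the conditional expectation of \<open>g(Y)\<close> given \<open>X\<close>;
  multiplying by \<open>\<rho>\<close> avoids dividing by a density that may vanish. For fixed \<open>x\<close> the largest \<open>f (x i)\<close>
  is attained at a single coordinate \<open>j\<close>, and there \<open>g (y j)\<close> is at most the maximum over all
  coordinates; Tonelli and the second marginal give the result.
\<close>

lemma nn_integral_Max_coupling:
  fixes f :: "'a \<Rightarrow> real" and g :: "'b \<Rightarrow> real" and k :: "'a \<Rightarrow> 'b \<Rightarrow> ennreal"
  assumes M: "sigma_finite_measure M" and N: "sigma_finite_measure N"
    and I: "finite I" "I \<noteq> {}"
    and f [measurable]: "f \<in> borel_measurable M" and g [measurable]: "g \<in> borel_measurable N"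
    and k [measurable]: "case_prod k \<in> borel_measurable (M \<Otimes>\<^sub>M N)"
    and row: "\<And>x. x \<in> space M \<Longrightarrow> (\<integral>\<^sup>+y. k x y \<partial>N) = \<rho> x"
    and col: "\<And>y. y \<in> space N \<Longrightarrow> (\<integral>\<^sup>+x. k x y \<partial>M) = \<sigma> y"
    and dom: "\<And>x. x \<in> space M \<Longrightarrow> \<rho> x * ennreal (f x) \<le> c * (\<integral>\<^sup>+y. k x y * ennreal (g y) \<partial>N)"
  shows "(\<integral>\<^sup>+x. (\<Prod>i\<in>I. \<rho> (x i)) * ennreal (MAX i\<in>I. f (x i)) \<partial>(\<Pi>\<^sub>M i\<in>I. M)) \<le>
     c * (\<integral>\<^sup>+y. (\<Prod>i\<in>I. \<sigma> (y i)) * ennreal (MAX i\<in>I. g (y i)) \<partial>(\<Pi>\<^sub>M i\<in>I. N))"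
proof -
  interpret PM: product_sigma_finite "\<lambda>_. M" using M by (simp add: product_sigma_finite_def)
  interpret PN: product_sigma_finite "\<lambda>_. N" using N by (simp add: product_sigma_finite_def)
  let ?M = "\<Pi>\<^sub>M i\<in>I. M" and ?N = "\<Pi>\<^sub>M i\<in>I. N"
  interpret M': sigma_finite_measure ?M by (rule PM.sigma_finite[OF I(1)])
  interpret N': sigma_finite_measure ?N by (rule PN.sigma_finite[OF I(1)])
  interpret MN: pair_sigma_finite ?M ?N ..
  define G where "G y = ennreal (MAX i\<in>I. g (y i))" for y
  have [measurable]: "G \<in> borel_measurable ?N"
    unfolding G_def using I by (intro measurable_compose[OF borel_measurable_Max measurable_ennreal]) auto
  have kI: "(\<lambda>(x, y). \<Prod>i\<in>I. k (x i) (y i)) \<in> borel_measurable (?M \<Otimes>\<^sub>M ?N)"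
    by measurable
  have kx [measurable]: "k x \<in> borel_measurable N" if "x \<in> space M" for x
    using that by measurable
  have ky [measurable]: "(\<lambda>x. k x y) \<in> borel_measurable M" if "y \<in> space N" for y
    using that by measurable
  have pointwise: "(\<Prod>i\<in>I. \<rho> (x i)) * ennreal (MAX i\<in>I. f (x i)) \<le>
      c * (\<integral>\<^sup>+y. (\<Prod>i\<in>I. k (x i) (y i)) * G y \<partial>?N)" if x: "x \<in> space ?M" for x
  proof -
    have xs: "x i \<in> space M" if "i \<in> I" for i using x that by (auto simp: space_PiM)
    have "Max ((\<lambda>i. f (x i)) ` I) \<in> (\<lambda>i. f (x i)) ` I" using I by (intro Max_in) auto
    then obtain j where j: "j \<in> I" "(MAX i\<in>I. f (x i)) = f (x j)" by auto
    define h where "h i y = k (x i) y * (if i = j then ennreal (g y) else 1)" for i y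
    have [measurable]: "h i \<in> borel_measurable N" if "i \<in> I" for i
      unfolding h_def using xs[OF that] by (cases "i = j") simp_all
    \<comment> \<open>Each coordinate other than \<open>j\<close> contributes its density as a row integral of \<open>k\<close>, so that the
      product over the coordinates is a single integral over the product space.\<close>
    have "(\<Prod>i\<in>I. \<rho> (x i)) * ennreal (f (x j)) = \<rho> (x j) * ennreal (f (x j)) * (\<Prod>i\<in>I-{j}. \<rho> (x i))"
      using I j by (simp add: prod.remove mult_ac)
    also have "\<dots> \<le> c * (\<integral>\<^sup>+y. h j y \<partial>N) * (\<Prod>i\<in>I-{j}. \<rho> (x i))"
      using dom[OF xs[OF j(1)]] by (intro mult_right_mono) (auto simp: h_def)
    also have "(\<Prod>i\<in>I-{j}. \<rho> (x i)) = (\<Prod>i\<in>I-{j}. \<integral>\<^sup>+y. h i y \<partial>N)"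
      by (intro prod.cong) (auto simp: h_def row xs)
    also have "c * (\<integral>\<^sup>+y. h j y \<partial>N) * \<dots> = c * (\<Prod>i\<in>I. \<integral>\<^sup>+y. h i y \<partial>N)"
      using I j by (simp add: prod.remove mult_ac)
    also have "(\<Prod>i\<in>I. \<integral>\<^sup>+y. h i y \<partial>N) = (\<integral>\<^sup>+y. (\<Prod>i\<in>I. h i (y i)) \<partial>?N)"
      using I by (intro PN.product_nn_integral_prod[symmetric]) auto
    also have "(\<lambda>y. \<Prod>i\<in>I. h i (y i)) = (\<lambda>y. (\<Prod>i\<in>I. k (x i) (y i)) * ennreal (g (y j)))"
      using I j by (simp add: h_def prod.distrib prod.delta)
    also have "c * (\<integral>\<^sup>+y. (\<Prod>i\<in>I. k (x i) (y i)) * ennreal (g (y j)) \<partial>?N)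
       \<le> c * (\<integral>\<^sup>+y. (\<Prod>i\<in>I. k (x i) (y i)) * G y \<partial>?N)"
      using I j unfolding G_def
      by (intro mult_left_mono nn_integral_mono ennreal_leI Max_ge) auto
    finally show ?thesis using j by simp
  qed
  have meas: "(\<lambda>(x, y). (\<Prod>i\<in>I. k (x i) (y i)) * G y) \<in> borel_measurable (?M \<Otimes>\<^sub>M ?N)"
    using kI by measurable
  have "(\<integral>\<^sup>+x. (\<Prod>i\<in>I. \<rho> (x i)) * ennreal (MAX i\<in>I. f (x i)) \<partial>?M)
      \<le> (\<integral>\<^sup>+x. c * (\<integral>\<^sup>+y. (\<Prod>i\<in>I. k (x i) (y i)) * G y \<partial>?N) \<partial>?M)"
    by (intro nn_integral_mono pointwise)
  also have "\<dots> = c * (\<integral>\<^sup>+x. \<integral>\<^sup>+y. (\<Prod>i\<in>I. k (x i) (y i)) * G y \<partial>?N \<partial>?M)"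
    using meas by (intro nn_integral_cmult) (rule N'.borel_measurable_nn_integral)
  also have "(\<integral>\<^sup>+x. \<integral>\<^sup>+y. (\<Prod>i\<in>I. k (x i) (y i)) * G y \<partial>?N \<partial>?M)
      = (\<integral>\<^sup>+y. \<integral>\<^sup>+x. (\<Prod>i\<in>I. k (x i) (y i)) * G y \<partial>?M \<partial>?N)"
    using MN.Fubini'[OF meas] by simp
  also have "\<dots> = (\<integral>\<^sup>+y. (\<Prod>i\<in>I. \<sigma> (y i)) * G y \<partial>?N)"
  proof (intro nn_integral_cong)
    fix y assume y: "y \<in> space ?N"
    have ys: "y i \<in> space N" if "i \<in> I" for i using y that by (auto simp: space_PiM)
    have [measurable]: "(\<lambda>x. \<Prod>i\<in>I. k (x i) (y i)) \<in> borel_measurable ?M"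
      using measurable_compose[OF measurable_Pair2'[OF y] kI] by simp
    have "(\<integral>\<^sup>+x. (\<Prod>i\<in>I. k (x i) (y i)) \<partial>?M) = (\<Prod>i\<in>I. \<sigma> (y i))"
      using I ys by (subst PM.product_nn_integral_prod) (auto simp: col intro!: prod.cong)
    then show "(\<integral>\<^sup>+x. (\<Prod>i\<in>I. k (x i) (y i)) * G y \<partial>?M) = (\<Prod>i\<in>I. \<sigma> (y i)) * G y"
      by (simp add: nn_integral_multc)
  qed
  finally show ?thesis unfolding G_def .
qed

section \<open>Fejer kernels and exact quadrature rules\<close>

text \<open>
  The Fejer kernel as the normalised squared modulus of a Dirichlet-type sum: nonnegativity is then
  immediate, and \<open>fejer_expand\<close> recovers its Fourier series, with coefficients \<open>1 - \<bar>k\<bar> / N\<close>, from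
  the pairs \<open>(j, l)\<close> with \<open>j - l = k\<close>. Integer indices make the differences \<open>j - l\<close> frequencies.
\<close>
definition fejer :: "nat \<Rightarrow> real \<Rightarrow> real" where
  "fejer N x = (cmod (\<Sum>j\<in>{0..<int N}. cis (of_int j * x)))\<^sup>2 / N"

lemma fejer_nonneg: "fejer N x \<ge> 0"
  by (simp add: fejer_def)

lemma fejer_expand:
  "complex_of_real (fejer N x) =
     (\<Sum>j\<in>{0..<int N}. \<Sum>l\<in>{0..<int N}. cis (of_int (j - l) * x)) / N"
  unfolding fejer_def of_real_divide complex_norm_square
  by (simp add: sum_product cis_cnj cis_mult algebra_simps flip: of_real_power)

lemma fejer_minus: "fejer N (- x) = fejer N x"
proof -
  have "complex_of_real (fejer N (- x)) = complex_of_real (fejer N x)"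
    unfolding fejer_expand by (subst sum.swap) (simp add: algebra_simps)
  then show ?thesis by simp
qed

lemma measurable_fejer [measurable]: "fejer N \<in> borel_measurable borel"
  unfolding fejer_def divide_inverse by (intro borel_measurable_continuous_onI continuous_intros)

lemma sum_diff_eq:
  fixes k :: int
  assumes "\<bar>k\<bar> \<le> int N"
  shows "(\<Sum>j\<in>{0..<int N}. \<Sum>l\<in>{0..<int N}. if j - l = k then 1 else 0) = (of_int (int N - \<bar>k\<bar>) :: complex)"
proof -
  have "(\<Sum>l\<in>{0..<int N}. if j - l = k then 1 else 0) = (if j \<in> {k..<int N + k} then 1 else (0::complex))" for j
  proof -
    have "(\<Sum>l\<in>{0..<int N}. if j - l = k then 1 else 0) = (\<Sum>l\<in>{0..<int N}. if j - k = l then 1 else (0::complex))"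
      by (intro sum.cong) auto
    also have "\<dots> = (if j - k \<in> {0..<int N} then 1 else 0)"
      by (rule sum.delta') simp
    finally show ?thesis by auto
  qed
  then have "(\<Sum>j\<in>{0..<int N}. \<Sum>l\<in>{0..<int N}. if j - l = k then 1 else 0)
     = (\<Sum>j\<in>{0..<int N} \<inter> {k..<int N + k}. (1::complex))"
    by (simp only: sum.inter_restrict finite_atLeastLessThan_int)
  also have "{0..<int N} \<inter> {k..<int N + k} = {max 0 k..<min (int N) (int N + k)}"
    by auto
  also have "(\<Sum>j\<in>\<dots>. (1::complex)) = of_nat (nat (int N - \<bar>k\<bar>))"
    by (simp add: abs_if min_def max_def)
  finally show ?thesis using assms by simp
qed

text \<open>
  Points \<open>t y\<close> with weights \<open>w y\<close> form a quadrature rule agreeing with the normalised Lebesgue integral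
  over a period on all frequencies below \<open>d\<close>. Keeping the weight apart from the measure lets the rule
  on \<open>[0, 2 pi]\<close> live on \<open>lborel\<close>, where the cube of integration becomes a product of weights.
\<close>
definition exact_rule :: "nat \<Rightarrow> 'a measure \<Rightarrow> ('a \<Rightarrow> real) \<Rightarrow> ('a \<Rightarrow> real) \<Rightarrow> bool" where
  "exact_rule d M w t \<longleftrightarrow> sigma_finite_measure M \<and> w \<in> borel_measurable M \<and> t \<in> borel_measurable M \<and>
     (\<forall>x. 0 \<le> w x) \<and>
     (\<forall>k::int. \<bar>k\<bar> < int d \<longrightarrow>
        has_bochner_integral M (\<lambda>y. of_real (w y) * cis (of_int k * t y)) (if k = 0 then 1 else 0))"

text \<open>
  Convolution with the Fejer kernel, computed by the rule, multiplies the frequency \<open>k\<close> by its Fejer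
  coefficient. The product of kernel and exponential only contains frequencies \<open>k - (j - l)\<close> of modulus
  at most \<open>\<bar>k\<bar> + N - 1\<close>, which is why \<open>\<bar>k\<bar> + N \<le> d\<close> suffices.
\<close>
lemma exact_rule_fejer:
  assumes R: "exact_rule d M w t" and N: "N \<ge> 1" and k: "\<bar>k\<bar> \<le> int N" "\<bar>k\<bar> + int N \<le> int d"
  shows "has_bochner_integral M (\<lambda>y. of_real (w y * fejer N (x - t y)) * cis (of_int k * t y))
     (of_real (of_int (int N - \<bar>k\<bar>) / N) * cis (of_int k * x))"
proof -
  let ?J = "{0..<int N}"
  let ?e = "\<lambda>m. \<lambda>y. of_real (w y) * cis (of_int m * t y)"
  have "has_bochner_integral M
      (\<lambda>y. \<Sum>j\<in>?J. \<Sum>l\<in>?J. cis (of_int (j - l) * x) / N * ?e (k - (j - l)) y)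
      (\<Sum>j\<in>?J. \<Sum>l\<in>?J. cis (of_int (j - l) * x) / N * (if k - (j - l) = 0 then 1 else 0))"
  proof (intro has_bochner_integral_sum has_bochner_integral_mult_right)
    fix j l assume "j \<in> ?J" "l \<in> ?J"
    then have "\<bar>k - (j - l)\<bar> < int d" using k by auto
    then show "has_bochner_integral M (?e (k - (j - l))) (if k - (j - l) = 0 then 1 else 0)"
      using R unfolding exact_rule_def by (elim conjE allE[of _ "k - (j - l)"] impE) auto
  qed
  also have "(\<lambda>y. \<Sum>j\<in>?J. \<Sum>l\<in>?J. cis (of_int (j - l) * x) / N * ?e (k - (j - l)) y)
      = (\<lambda>y. of_real (w y * fejer N (x - t y)) * cis (of_int k * t y))"
  proof
    fix y
    have "of_real (w y * fejer N (x - t y)) * cis (of_int k * t y)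
       = (\<Sum>j\<in>?J. \<Sum>l\<in>?J. of_real (w y) / N * (cis (of_int (j - l) * (x - t y)) * cis (of_int k * t y)))"
      unfolding of_real_mult fejer_expand
      by (simp add: sum_distrib_left sum_distrib_right sum_divide_distrib mult_ac)
    also have "\<dots> = (\<Sum>j\<in>?J. \<Sum>l\<in>?J. of_real (w y) / N * (cis (of_int (j - l) * x) * cis (of_int (k - (j - l)) * t y)))"
      unfolding cis_mult by (simp add: algebra_simps)
    finally show "(\<Sum>j\<in>?J. \<Sum>l\<in>?J. cis (of_int (j - l) * x) / N * ?e (k - (j - l)) y)
      = of_real (w y * fejer N (x - t y)) * cis (of_int k * t y)"
      by (simp add: mult_ac)
  qed
  also have "(\<Sum>j\<in>?J. \<Sum>l\<in>?J. cis (of_int (j - l) * x) / N * (if k - (j - l) = 0 then 1 else 0))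
      = cis (of_int k * x) / N * (\<Sum>j\<in>?J. \<Sum>l\<in>?J. if j - l = k then 1 else 0)"
    unfolding sum_distrib_left by (intro sum.cong) auto
  also have "\<dots> = of_real (of_int (int N - \<bar>k\<bar>) / N) * cis (of_int k * x)"
    unfolding sum_diff_eq[OF k(1)] by (simp flip: of_int_abs)
  finally show ?thesis .
qed

section \<open>Transference between exact quadrature rules\<close>

text \<open>The nonnegative majorant of the de la Vallee Poussin kernel \<open>2 F\<^sub>2\<^sub>n - F\<^sub>n\<close>.\<close>
definition vp_majorant :: "nat \<Rightarrow> real \<Rightarrow> real" where
  "vp_majorant n x = 2 * fejer (2 * n) x + fejer n x"

lemma vp_majorant_nonneg: "vp_majorant n x \<ge> 0"
  by (simp add: vp_majorant_def fejer_nonneg)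

lemma vp_majorant_minus: "vp_majorant n (x - y) = vp_majorant n (y - x)"
  using fejer_minus[of _ "x - y"] by (simp add: vp_majorant_def)

lemma measurable_vp_majorant [measurable]: "vp_majorant n \<in> borel_measurable borel"
  unfolding vp_majorant_def by measurable

lemma nn_integral_vp_majorant:
  assumes R: "exact_rule d M w t" and n: "n \<ge> 1" "3 * n \<le> d"
  shows "(\<integral>\<^sup>+y. ennreal (w y * vp_majorant n (x - t y)) \<partial>M) = 3"
proof -
  have *: "has_bochner_integral M (\<lambda>y. complex_of_real (w y * fejer N (x - t y))) 1" if "N \<ge> 1" "N \<le> d" for N
    using exact_rule_fejer[OF R, of N 0 x] that by simp
  have "has_bochner_integral M (\<lambda>y. 2 * complex_of_real (w y * fejer (2*n) (x - t y)) + of_real (w y * fejer n (x - t y)))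
     (2 * 1 + 1)"
    using n by (intro has_bochner_integral_add has_bochner_integral_mult_right *) auto
  also have "(\<lambda>y. 2 * complex_of_real (w y * fejer (2*n) (x - t y)) + of_real (w y * fejer n (x - t y)))
     = (\<lambda>y. complex_of_real (w y * vp_majorant n (x - t y)))"
    by (simp add: vp_majorant_def algebra_simps)
  finally have "has_bochner_integral M (\<lambda>y. complex_of_real (w y * vp_majorant n (x - t y))) (of_real 3)" by simp
  from has_bochner_integral_Re[OF this]
  have "has_bochner_integral M (\<lambda>y. w y * vp_majorant n (x - t y)) 3" by simp
  then have "(\<integral>\<^sup>+y. ennreal (w y * vp_majorant n (x - t y)) \<partial>M) = ennreal 3"
    using R by (subst nn_integral_eq_integral)
      (auto simp: has_bochner_integral_iff exact_rule_def vp_majorant_nonneg)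
  then show ?thesis by simp
qed

lemma trig_poly_cis:
  assumes "trig_poly n P"
  obtains c where "P = (\<lambda>x. \<Sum>k=-int n..int n. c k * cis (of_int k * x))"
  using assms by (auto simp: trig_poly_def cis_conv_exp mult_ac)

lemma trig_poly_measurable [measurable_dest]: "trig_poly n P \<Longrightarrow> P \<in> borel_measurable borel"
  by (erule trig_poly_cis) (auto intro!: borel_measurable_continuous_onI continuous_intros)

text \<open>
  The rule reproduces \<open>P\<close> under convolution with \<open>V = 2 F\<^sub>2\<^sub>n - F\<^sub>n\<close>: at a frequency \<open>\<bar>k\<bar> \<le> n\<close> the
  coefficient of \<open>V\<close> is \<open>2 (1 - \<bar>k\<bar> / 2n) - (1 - \<bar>k\<bar> / n) = 1\<close>. Exactness is used for frequencies up to
  \<open>n + (2n - 1)\<close>, whence \<open>3n\<close>.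
\<close>
lemma trig_poly_le_vp_average:
  assumes R: "exact_rule d M w t" and n: "n \<ge> 1" "3 * n \<le> d" and P: "trig_poly n P"
  shows "ennreal (cmod (P x)) \<le> (\<integral>\<^sup>+y. ennreal (w y * vp_majorant n (x - t y) * cmod (P (t y))) \<partial>M)"
proof -
  obtain c where c: "P = (\<lambda>x. \<Sum>k=-int n..int n. c k * cis (of_int k * x))"
    using trig_poly_cis[OF P] .
  define V where "V z = 2 * fejer (2 * n) z - fejer n z" for z
  let ?K = "{-int n..int n}"
  have Vk: "has_bochner_integral M (\<lambda>y. of_real (w y * V (x - t y)) * cis (of_int k * t y)) (cis (of_int k * x))"
    if k: "k \<in> ?K" for k
  proof -
    have "has_bochner_integral M
       (\<lambda>y. 2 * (of_real (w y * fejer (2*n) (x - t y)) * cis (of_int k * t y)) - of_real (w y * fejer n (x - t y)) * cis (of_int k * t y))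
       (2 * (of_real (of_int (int (2 * n) - \<bar>k\<bar>) / (2 * n)) * cis (of_int k * x)) - of_real (of_int (int n - \<bar>k\<bar>) / n) * cis (of_int k * x))"
    proof (intro has_bochner_integral_diff has_bochner_integral_mult_right)
      have "1 \<le> 2 * n" "\<bar>k\<bar> \<le> int (2 * n)" "\<bar>k\<bar> + int (2 * n) \<le> int d"
        using n k by auto
      then show "has_bochner_integral M (\<lambda>y. of_real (w y * fejer (2*n) (x - t y)) * cis (of_int k * t y))
         (of_real (of_int (int (2 * n) - \<bar>k\<bar>) / (2 * n)) * cis (of_int k * x))"
        by (rule exact_rule_fejer[OF R])
      have "1 \<le> n" "\<bar>k\<bar> \<le> int n" "\<bar>k\<bar> + int n \<le> int d"
        using n k by auto
      then show "has_bochner_integral M (\<lambda>y. of_real (w y * fejer n (x - t y)) * cis (of_int k * t y))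
         (of_real (of_int (int n - \<bar>k\<bar>) / n) * cis (of_int k * x))"
        by (rule exact_rule_fejer[OF R])
    qed
    also have "(\<lambda>y. 2 * (of_real (w y * fejer (2*n) (x - t y)) * cis (of_int k * t y)) - of_real (w y * fejer n (x - t y)) * cis (of_int k * t y))
        = (\<lambda>y. of_real (w y * V (x - t y)) * cis (of_int k * t y))"
      by (simp add: V_def algebra_simps)
    also have "2 * (of_real (of_int (int (2 * n) - \<bar>k\<bar>) / (2 * n)) * cis (of_int k * x)) - of_real (of_int (int n - \<bar>k\<bar>) / n) * cis (of_int k * x)
        = cis (of_int k * x)"
      using n by (simp add: field_simps)
    finally show ?thesis .
  qed
  have "has_bochner_integral M (\<lambda>y. \<Sum>k\<in>?K. c k * (of_real (w y * V (x - t y)) * cis (of_int k * t y)))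
     (\<Sum>k\<in>?K. c k * cis (of_int k * x))"
    by (intro has_bochner_integral_sum has_bochner_integral_mult_right Vk)
  also have "(\<lambda>y. \<Sum>k\<in>?K. c k * (of_real (w y * V (x - t y)) * cis (of_int k * t y)))
     = (\<lambda>y. of_real (w y * V (x - t y)) * P (t y))"
    by (simp add: c sum_distrib_left mult_ac)
  finally have *: "has_bochner_integral M (\<lambda>y. of_real (w y * V (x - t y)) * P (t y)) (P x)"
    by (simp add: c)
  then have "ennreal (cmod (P x)) \<le> (\<integral>\<^sup>+y. ennreal (cmod (of_real (w y * V (x - t y)) * P (t y))) \<partial>M)"
    using integral_norm_bound_ennreal by (metis has_bochner_integral_iff)
  also have "\<dots> \<le> (\<integral>\<^sup>+y. ennreal (w y * vp_majorant n (x - t y) * cmod (P (t y))) \<partial>M)"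
  proof (intro nn_integral_mono ennreal_leI)
    fix y
    have "\<bar>V (x - t y)\<bar> \<le> vp_majorant n (x - t y)"
      using fejer_nonneg[of n "x - t y"] fejer_nonneg[of "2*n" "x - t y"]
      by (simp add: V_def vp_majorant_def)
    moreover have "0 \<le> w y" using R by (simp add: exact_rule_def)
    ultimately show "cmod (of_real (w y * V (x - t y)) * P (t y)) \<le> w y * vp_majorant n (x - t y) * cmod (P (t y))"
      by (auto simp: norm_mult abs_mult intro!: mult_right_mono mult_left_mono)
  qed
  finally show ?thesis .
qed

definition rule_max_mean :: "'a measure \<Rightarrow> ('a \<Rightarrow> real) \<Rightarrow> ('a \<Rightarrow> real) \<Rightarrow> nat \<Rightarrow> (real \<Rightarrow> complex) \<Rightarrow> ennreal" where
  "rule_max_mean M w t m P =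
     (\<integral>\<^sup>+x. (\<Prod>i\<in>{1..m}. ennreal (w (x i))) * ennreal (MAX j\<in>{1..m}. cmod (P (t (x j)))) \<partial>(\<Pi>\<^sub>M i\<in>{1..m}. M))"

text \<open>
  The product \<open>w(x) v(y) K(t x - s y) / 3\<close> couples the two rules: by the evenness of \<open>K\<close> the mass
  computation \<open>nn_integral_vp_majorant\<close> yields both marginals.
\<close>
lemma rule_max_mean_transfer:
  assumes R: "exact_rule d M w t" and R': "exact_rule d' N v s"
    and d: "3 * n \<le> d" "3 * n \<le> d'" and n: "n \<ge> 1" and m: "m \<ge> 1" and P: "trig_poly n P"
  shows "rule_max_mean M w t m P \<le> 3 * rule_max_mean N v s m P"
  unfolding rule_max_mean_def
proof (rule nn_integral_Max_coupling)
  define k where "k x y = ennreal (w x * v y * vp_majorant n (t x - s y) / 3)" for x y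
  have [measurable]: "P \<in> borel_measurable borel" using P by (rule trig_poly_measurable)
  have [measurable]: "w \<in> borel_measurable M" "t \<in> borel_measurable M" "v \<in> borel_measurable N" "s \<in> borel_measurable N"
    using R R' by (auto simp: exact_rule_def)
  have nn: "0 \<le> w x" "0 \<le> v y" for x y using R R' by (auto simp: exact_rule_def)
  have third: "ennreal (a / 3) * 3 = ennreal a" if "0 \<le> a" for a
    using that ennreal_mult[of "a / 3" 3] by simp
  show "sigma_finite_measure M" "sigma_finite_measure N" using R R' by (auto simp: exact_rule_def)
  show "finite {1..m}" "{1..m} \<noteq> {}" using m by auto
  show "(\<lambda>x. cmod (P (t x))) \<in> borel_measurable M" "(\<lambda>y. cmod (P (s y))) \<in> borel_measurable N"
    by measurable
  show "case_prod k \<in> borel_measurable (M \<Otimes>\<^sub>M N)" unfolding k_def by measurable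
  show "(\<integral>\<^sup>+y. k x y \<partial>N) = ennreal (w x)" for x
  proof -
    have "(\<integral>\<^sup>+y. k x y \<partial>N) = (\<integral>\<^sup>+y. ennreal (w x / 3) * ennreal (v y * vp_majorant n (t x - s y)) \<partial>N)"
      using nn vp_majorant_nonneg by (simp add: k_def mult_ac flip: ennreal_mult)
    also have "\<dots> = ennreal (w x / 3) * 3"
      using nn_integral_vp_majorant[OF R' n d(2)] by (simp add: nn_integral_cmult)
    finally show ?thesis using nn third by simp
  qed
  show "(\<integral>\<^sup>+x. k x y \<partial>M) = ennreal (v y)" for y
  proof -
    have "(\<integral>\<^sup>+x. k x y \<partial>M) = (\<integral>\<^sup>+x. ennreal (v y / 3) * ennreal (w x * vp_majorant n (s y - t x)) \<partial>M)"
      using nn vp_majorant_nonneg vp_majorant_minus[of n "s y"]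
      by (simp add: k_def mult_ac flip: ennreal_mult)
    also have "\<dots> = ennreal (v y / 3) * 3"
      using nn_integral_vp_majorant[OF R n d(1)] by (simp add: nn_integral_cmult)
    finally show ?thesis using nn third by simp
  qed
  show "ennreal (w x) * ennreal (cmod (P (t x))) \<le> 3 * (\<integral>\<^sup>+y. k x y * ennreal (cmod (P (s y))) \<partial>N)" for x
  proof -
    have "ennreal (w x) * ennreal (cmod (P (t x))) \<le>
        ennreal (w x) * (\<integral>\<^sup>+y. ennreal (v y * vp_majorant n (t x - s y) * cmod (P (s y))) \<partial>N)"
      by (intro mult_left_mono trig_poly_le_vp_average[OF R' n d(2) P]) simp
    also have "\<dots> = (\<integral>\<^sup>+y. ennreal (w x) * ennreal (v y * vp_majorant n (t x - s y) * cmod (P (s y))) \<partial>N)"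
      by (intro nn_integral_cmult[symmetric]) measurable
    also have "\<dots> = (\<integral>\<^sup>+y. ennreal 3 * (k x y * ennreal (cmod (P (s y)))) \<partial>N)"
      using nn vp_majorant_nonneg unfolding k_def by (simp add: mult_ac flip: ennreal_mult del: ennreal_numeral)
    also have "\<dots> = ennreal 3 * (\<integral>\<^sup>+y. k x y * ennreal (cmod (P (s y))) \<partial>N)"
      by (intro nn_integral_cmult) (simp add: k_def)
    finally show ?thesis by simp
  qed
qed

section \<open>Lebesgue measure and the equispaced grid as exact rules\<close>

lemma exact_rule_lebesgue: "exact_rule d lborel (\<lambda>x. indicator {0..2 * pi} x / (2 * pi)) (\<lambda>x. x)"
  unfolding exact_rule_def
proof (intro conjI allI impI)
  fix k :: int
  let ?e = "\<lambda>x. cis (of_int k * x)"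
  let ?v = "if k = 0 then 1 else 0 :: complex"
  define F where "F x = (if k = 0 then of_real x else ?e x / (\<i> * of_int k))" for x
  have "has_bochner_integral lborel (\<lambda>x. indicator {0..2*pi} x *\<^sub>R ?e x) (F (2 * pi) - F 0)"
  proof (rule has_bochner_integral_FTC_Icc)
    fix x :: real
    show "(F has_vector_derivative ?e x) (at x within {0..2*pi})"
    proof (cases "k = 0")
      case True
      then show ?thesis unfolding F_def by (auto intro!: derivative_eq_intros)
    next
      case False
      have "((\<lambda>x. ?e x) has_vector_derivative of_int k *\<^sub>R (\<i> * ?e x)) (at x within {0..2*pi})"
        unfolding has_vector_derivative_def by (auto intro!: derivative_eq_intros simp: mult_ac scaleR_conv_of_real)
      then have "((\<lambda>x. ?e x / (\<i> * of_int k)) has_vector_derivative (of_int k *\<^sub>R (\<i> * ?e x)) / (\<i> * of_int k)) (at x within {0..2*pi})"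
        by (rule has_vector_derivative_divide)
      then show ?thesis using False unfolding F_def by (simp add: scaleR_conv_of_real)
    qed
  qed (auto intro!: continuous_intros)
  moreover have "F (2 * pi) - F 0 = 2 * pi * ?v"
    using cis_multiple_2pi[of "of_int k"] by (simp add: F_def mult_ac)
  ultimately have "has_bochner_integral lborel (\<lambda>x. of_real (1 / (2 * pi)) * (indicator {0..2*pi} x *\<^sub>R ?e x)) (of_real (1 / (2 * pi)) * (2 * pi * ?v))"
    by (intro has_bochner_integral_mult_right) simp
  also have "(\<lambda>x. of_real (1 / (2 * pi)) * (indicator {0..2*pi} x *\<^sub>R ?e x))
     = (\<lambda>x. of_real (indicator {0..2 * pi} x / (2 * pi)) * ?e x)"
    by (auto simp: indicator_def)
  also have "of_real (1 / (2 * pi)) * (2 * pi * ?v) = ?v" by simp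
  finally show "has_bochner_integral lborel (\<lambda>x. of_real (indicator {0..2 * pi} x / (2 * pi)) * ?e x) ?v" .
qed (auto intro: sigma_finite_lborel)

lemma sum_cis_equispaced:
  fixes k :: int
  assumes "0 < N" "\<bar>k\<bar> < int N"
  shows "(\<Sum>i<N. cis (of_int k * (real i / N * (2 * pi)))) = (if k = 0 then of_nat N else 0)"
proof (cases "k = 0")
  case False
  define z where "z = cis (of_int k * (2 * pi) / N)"
  have z: "cis (of_int k * (real i / N * (2 * pi))) = z ^ i" for i
    unfolding z_def Complex.DeMoivre by (simp add: mult_ac)
  have "z \<noteq> 1"
  proof
    assume "z = 1"
    then obtain q :: int where "of_int k * (2 * pi) / N = of_int q * (2 * pi)"
      unfolding z_def cis_eq_1_iff by auto
    then have "real_of_int k = of_int (q * int N)" using assms by (simp add: field_simps)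
    then have "int N dvd k" by (simp only: of_int_eq_iff) simp
    then show False using zdvd_imp_le[of "int N" "\<bar>k\<bar>"] assms False by auto
  qed
  moreover have "z ^ N = 1"
    unfolding z_def Complex.DeMoivre using assms cis_multiple_2pi[of "of_int k"] by (simp add: mult_ac)
  ultimately show ?thesis using False unfolding z by (simp add: sum_gp_strict)
qed simp

lemma exact_rule_grid:
  assumes "n \<ge> 1"
  shows "exact_rule (8 * n) (count_space {1..8 * n}) (\<lambda>_. 1 / real (8 * n)) (grid_point n)"
  unfolding exact_rule_def
proof (intro conjI allI impI)
  fix k :: int assume k: "\<bar>k\<bar> < int (8 * n)"
  let ?f = "\<lambda>y. of_real (1 / real (8 * n)) * cis (of_int k * grid_point n y)"
  have "(\<Sum>y\<in>{1..8*n}. cis (of_int k * grid_point n y)) = (\<Sum>i<8*n. cis (of_int k * (real i / real (8 * n) * (2 * pi))))"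
    by (rule sum.reindex_bij_witness[of _ Suc "\<lambda>y. y - 1"]) (auto simp: grid_point_def of_nat_diff)
  also have "\<dots> = (if k = 0 then of_nat (8 * n) else 0)"
    using assms k by (intro sum_cis_equispaced) auto
  finally have "(\<Sum>y\<in>{1..8*n}. ?f y) = (if k = 0 then 1 else 0)"
    using assms unfolding sum_distrib_left[symmetric] by simp
  then show "has_bochner_integral (count_space {1..8 * n}) ?f (if k = 0 then 1 else 0)"
    unfolding has_bochner_integral_iff
    by (simp only: lebesgue_integral_count_space_finite integrable_count_space finite_atLeastAtMost)
qed (auto intro: sigma_finite_measure_count_space_finite)

lemma vec_norm_eq_rule_max_mean:
  assumes "m \<ge> 1"
  shows "ennreal (vec_norm_minf (8 * n) m (\<lambda>k. P (grid_point n k))) =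
     rule_max_mean (count_space {1..8 * n}) (\<lambda>_. 1 / real (8 * n)) (grid_point n) m P"
proof -
  let ?S = "{1..m} \<rightarrow>\<^sub>E {1..8*n}"
  let ?g = "\<lambda>x. MAX j\<in>{1..m}. cmod (P (grid_point n (x j)))"
  have g: "0 \<le> ?g x" for x
    using assms by (intro Max_ge_iff[THEN iffD2]) auto
  have fin: "finite ?S" by (intro finite_PiE) auto
  have "(\<Pi>\<^sub>M i\<in>{1..m}. count_space {1..8*n}) = count_space ?S"
    by (intro count_space_PiM_finite) auto
  then have "rule_max_mean (count_space {1..8 * n}) (\<lambda>_. 1 / real (8 * n)) (grid_point n) m P
      = (\<Sum>x\<in>?S. ennreal ((1 / real (8 * n)) ^ m * ?g x))"
    unfolding rule_max_mean_def using fin g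
    by (simp add: nn_integral_count_space_finite ennreal_mult ennreal_power)
  also have "\<dots> = ennreal (\<Sum>x\<in>?S. (1 / real (8 * n)) ^ m * ?g x)"
    using g by (intro sum_ennreal) auto
  also have "(\<Sum>x\<in>?S. (1 / real (8 * n)) ^ m * ?g x) = vec_norm_minf (8 * n) m (\<lambda>k. P (grid_point n k))"
    by (simp add: vec_norm_minf_def sum_distrib_left power_divide)
  finally show ?thesis ..
qed

lemma fun_norm_eq_rule_max_mean:
  assumes m: "m \<ge> 1" and P: "trig_poly n P"
  shows "fun_norm_minf m P =
     enn2real (rule_max_mean lborel (\<lambda>x. indicator {0..2 * pi} x / (2 * pi)) (\<lambda>x. x) m P)"
proof -
  let ?L = "\<Pi>\<^sub>M j\<in>{1..m}. lborel :: real measure"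
  let ?S = "{1..m} \<rightarrow>\<^sub>E {0..2 * pi}"
  let ?g = "\<lambda>x. MAX j\<in>{1..m}. cmod (P (x j))"
  have [measurable]: "P \<in> borel_measurable borel" using P by (rule trig_poly_measurable)
  have g: "0 \<le> ?g x" for x
    using m by (intro Max_ge_iff[THEN iffD2]) auto
  have [measurable]: "?g \<in> borel_measurable ?L"
    by (intro borel_measurable_Max) auto
  have [measurable]: "?S \<in> sets ?L" by (intro sets_PiM_I_finite) auto
  have ind: "(\<Prod>i\<in>{1..m}. indicator {0..2 * pi} (x i) / (2 * pi)) = 1 / (2 * pi) ^ m * (indicator ?S x :: real)"
    if "x \<in> space ?L" for x
  proof -
    have "(\<Prod>i\<in>{1..m}. indicator {0..2 * pi} (x i)) = (indicator ?S x :: real)"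
      using that by (auto simp: space_PiM PiE_iff indicator_def of_bool_def)
    then show ?thesis by (simp add: prod_dividef)
  qed
  have "rule_max_mean lborel (\<lambda>x. indicator {0..2 * pi} x / (2 * pi)) (\<lambda>x. x) m P
     = (\<integral>\<^sup>+x. ennreal (1 / (2 * pi) ^ m * (indicator ?S x * ?g x)) \<partial>?L)"
    unfolding rule_max_mean_def
  proof (intro nn_integral_cong)
    fix x :: "nat \<Rightarrow> real" assume x: "x \<in> space ?L"
    have "(\<Prod>i\<in>{1..m}. ennreal (indicator {0..2 * pi} (x i) / (2 * pi))) = ennreal (1 / (2 * pi) ^ m * indicator ?S x)"
      unfolding ind[OF x, symmetric] by (intro prod_ennreal) auto
    then show "(\<Prod>i\<in>{1..m}. ennreal (indicator {0..2 * pi} (x i) / (2 * pi))) * ennreal (?g x)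
        = ennreal (1 / (2 * pi) ^ m * (indicator ?S x * ?g x))"
      using g by (simp add: mult_ac flip: ennreal_mult)
  qed
  then have "enn2real (rule_max_mean lborel (\<lambda>x. indicator {0..2 * pi} x / (2 * pi)) (\<lambda>x. x) m P)
     = (LINT x|?L. 1 / (2 * pi) ^ m * (indicator ?S x * ?g x))"
    using g by (subst integral_eq_nn_integral) auto
  also have "\<dots> = fun_norm_minf m P"
    unfolding fun_norm_minf_def set_lebesgue_integral_def by simp
  finally show ?thesis ..
qed

theorem theorem4:
  shows "\<exists>C9 C10 :: real. C9 > 0 \<and> C10 > 0 \<and>
    (\<forall>(n::nat) (m::nat) (P :: real \<Rightarrow> complex). n \<ge> 1 \<longrightarrow> m \<ge> 1 \<longrightarrow> trig_poly n P \<longrightarrow>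
       C9 * vec_norm_minf (8 * n) m (\<lambda>k. P (grid_point n k)) \<le> fun_norm_minf m P \<and>
       fun_norm_minf m P \<le> C10 * vec_norm_minf (8 * n) m (\<lambda>k. P (grid_point n k)))"
proof (rule exI[of _ "1/3"], rule exI[of _ 3], intro conjI allI impI)
  fix n m :: nat and P :: "real \<Rightarrow> complex"
  assume n: "n \<ge> 1" and m: "m \<ge> 1" and P: "trig_poly n P"
  define A where "A = rule_max_mean lborel (\<lambda>x. indicator {0..2 * pi} x / (2 * pi)) (\<lambda>x. x) m P"
  define b where "b = vec_norm_minf (8 * n) m (\<lambda>k. P (grid_point n k))"
  have b0: "0 \<le> b"
    unfolding b_def vec_norm_minf_def using m
    by (intro mult_nonneg_nonneg sum_nonneg Max_ge_iff[THEN iffD2]) auto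
  have B: "rule_max_mean (count_space {1..8 * n}) (\<lambda>_. 1 / real (8 * n)) (grid_point n) m P = ennreal b"
    unfolding b_def vec_norm_eq_rule_max_mean[OF m] ..
  have d: "3 * n \<le> 8 * n" by simp
  have le: "A \<le> 3 * ennreal b"
    unfolding A_def B[symmetric]
    by (rule rule_max_mean_transfer[OF exact_rule_lebesgue exact_rule_grid[OF n] d d n m P])
  have ge: "ennreal b \<le> 3 * A"
    unfolding A_def B[symmetric]
    by (rule rule_max_mean_transfer[OF exact_rule_grid[OF n] exact_rule_lebesgue d d n m P])
  have "3 * ennreal b = ennreal (3 * b)" using b0 by (simp add: ennreal_mult)
  \<comment> \<open>A Bochner integral is 0 when the Lebesgue integral is infinite, so the upper bound, which gives
    finiteness, has to come before the lower bound.\<close>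
  then have "A < top" using le by (metis ennreal_less_top le_less_trans infinity_ennreal_def)
  then have A: "A = ennreal (fun_norm_minf m P)" "0 \<le> fun_norm_minf m P"
    unfolding fun_norm_eq_rule_max_mean[OF m P] A_def by simp_all
  have "ennreal (fun_norm_minf m P) \<le> ennreal (3 * b)" "ennreal b \<le> ennreal (3 * fun_norm_minf m P)"
    using le ge b0 A(2) by (simp_all add: A(1) ennreal_mult)
  then have "fun_norm_minf m P \<le> 3 * b" "b \<le> 3 * fun_norm_minf m P"
    using b0 A(2) by (simp_all del: ennreal_mult)
  then show "1 / 3 * vec_norm_minf (8 * n) m (\<lambda>k. P (grid_point n k)) \<le> fun_norm_minf m P"
    "fun_norm_minf m P \<le> 3 * vec_norm_minf (8 * n) m (\<lambda>k. P (grid_point n k))"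
    by (simp_all add: b_def)
qed simp_all

end
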